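(* Let $N,M,N'\geq 1$ be integers (precisions) with $N'\geq N$. Let $z_a=x_a+iy_a$ and $z_b=x_b+iy_b$ be centers in $\mathcal{R}_N+i\mathcal{R}_N$ and $r_a,r_b\in\mathcal{R}_M$ be radii. (1) Sum of disks: $$D(z_a,r_a)+D(z_b,r_b)\subset D\left(z_a+_N z_b,\ R_M^+\left(r_a+r_b+\tfrac12\mathrm{ulp}(z_a+_N z_b)\right)\right).$$ (2) Product of exact centers: $z_az_b\in D\left(z_a\times_{N,N'}z_b,\ R_\ast\right)$, where $$R_\ast=R_M^+\left(\tfrac12\mathrm{ulp}(z_a\times_{N,N'}z_b)+\tfrac12\sum_{u\in\{x_a,y_a\},\ v\in\{x_b,y_b\}}\mathrm{ulp}(u\times_{N'}v)\right)$$ (the sum has four terms, one for each choice of the pair of factors $u$ and $v$). (3) Product of disks: $$D(z_a,r_a)\times D(z_b,r_b)\subset D\left(z_a\times_{N,N'}z_b,\ R_M^+\left(r_ar_b+r_a|z_b|+r_b|z_a|+R_\ast\right)\right).$$ (4) Scaling: if $x\in\mathcal{R}_N$ and $r\in\mathcal{R}_M$ is a radius, then $$I(x,r)\times D(z_a,r_a)\subset D\left(x\times_N z_a,\ R_M^+\left((|x|+r)r_a+r|z_a|+\tfrac12\mathrm{ulp}(x\times_N z_a)\right)\right).$$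
   Context: $D(z,r)=\{z'\in\mathbb{C}:|z'-z|<r\}$ and $I(x,r)=(x-r,x+r)\subset\mathbb{R}$. Sums and products of sets are Minkowski ones: $A+B=\{a+b\}$, $A\times B=\{ab\}$ with $a\in A,b\in B$. Finite precision numbers: for $N\geq1$ let $\mathcal{Z}_N=\{\pm 2^{-N}m : m\in\mathbb{Z},\ 2^{N-1}\leq m\leq 2^N-1\}$, let $\hat{\mathcal{R}}_N=\{0\}\cup\bigcup_{e\in\mathbb{Z}}2^e\mathcal{Z}_N$, and let $$\mathcal{R}_N=\{\pm0\}\cup\bigcup_{e=e_{\min}}^{e_{\max}}2^e\mathcal{Z}_N\cup\{\pm\infty,\mathrm{NaN}\},$$ where $-e_{\min}$ and $e_{\max}$ are fixed large positive integers (the same for all precisions). For $x\in 2^e\mathcal{Z}_N$ the exponent is $e(x)=e$. Rounding: $R_N:\mathbb{R}\to\mathcal{R}_N$ rounds to the nearest point of $\hat{\mathcal{R}}_N$, except that $R_N(x)=0$ if $|x|<2^{e_{\min}}$ (flush to zero), and $R_N(x)=\pm\infty$ (with the sign of $x$) if $|x|>2^{e_{\max}}(1-2^{-N})$. $R_M^+$ is the operator that always rounds up, to an element of $\mathcal{R}_M$ (so $R_M^+(x)\geq x$). Unit on last position: for a regular nonzero $x\in\mathcal{R}_N$ (with $e_{\min}\leq e(x)\leq e_{\max}$), $\mathrm{ulp}(x)=2^{e(x)-N}$; $\mathrm{ulp}(\pm0)=2^{1+e_{\min}}$; $\mathrm{ulp}(\pm\infty)=\infty$. The ulp of a result is computed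 with respect to the precision of that result: precision $N$ for $z_a+_Nz_b$, $z_a\times_{N,N'}z_b$, $x\times_Nz_a$, and precision $N'$ for $u\times_{N'}v$. For complex numbers, $\mathrm{ulp}(x+iy)=\sqrt{\mathrm{ulp}(x)^2+\mathrm{ulp}(y)^2}$. Operations: on reals, $x+_Ny=R_N(x+y)$, $x-_Ny=R_N(x-y)$, $x\times_Ny=R_N(xy)$. On complex numbers, $z_a+_Nz_b=(x_a+_Nx_b)+i(y_a+_Ny_b)$, $\ x\times_N z_a=(x\times_Nx_a)+i(x\times_Ny_a)$ for real $x$, and $$z_a\times_{N,N'}z_b=\left[(x_a\times_{N'}x_b)-_N(y_a\times_{N'}y_b)\right]+i\left[(x_a\times_{N'}y_b)+_N(y_a\times_{N'}x_b)\right].$$ Input centers and $x$ are finite numbers and radii are nonnegative; if some rounding overflows (an intermediate or final value is infinite or NaN), the resulting radius is $+\infty$ and the corresponding disk is understood to be all of $\mathbb{C}$. *)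

theory Defs
  imports "HOL-Analysis.Analysis" "HOL-Library.Set_Algebras" "HOL-Library.Extended_Real"
begin

text \<open>
  Floating-point numbers, rounding and unit on last position. The exponent range
  is given by the parameters \<open>emin\<close> and \<open>emax\<close>, which are the same for all precisions.
\<close>

datatype fpnum = PosZero | NegZero | Regular real | PosInf | NegInf | NaN

definition mantissas :: "nat \<Rightarrow> real set" where
  "mantissas N = {z. \<exists>m::int. 2 ^ (N - 1) \<le> m \<and> m \<le> 2 ^ N - 1 \<and>
     (z = 2 powi (- int N) * real_of_int m \<or> z = - (2 powi (- int N) * real_of_int m))}"

definition binade :: "nat \<Rightarrow> int \<Rightarrow> real set" where
  "binade N e = (\<lambda>z. 2 powi e * z) ` mantissas N"

definition unbounded_reals :: "nat \<Rightarrow> real set" where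
  "unbounded_reals N = {0} \<union> (\<Union>e. binade N e)"

definition fpnums :: "int \<Rightarrow> int \<Rightarrow> nat \<Rightarrow> fpnum set" where
  "fpnums emin emax N =
     {PosZero, NegZero} \<union> Regular ` (\<Union>e\<in>{emin..emax}. binade N e) \<union> {PosInf, NegInf, NaN}"

definition exponent :: "nat \<Rightarrow> real \<Rightarrow> int" where
  "exponent N x = (THE e. x \<in> binade N e)"

definition is_finite :: "fpnum \<Rightarrow> bool" where
  "is_finite x \<longleftrightarrow> x \<notin> {PosInf, NegInf, NaN}"

text \<open>
  The value of \<open>NaN\<close> only matters when it is a radius; such a radius stands for \<open>\<infinity>\<close>.
\<close>

fun extval :: "fpnum \<Rightarrow> ereal" where
  "extval PosZero = 0"
| "extval NegZero = 0"
| "extval (Regular x) = ereal x"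
| "extval PosInf = \<infinity>"
| "extval NegInf = - \<infinity>"
| "extval NaN = \<infinity>"

definition val :: "fpnum \<Rightarrow> real" where
  "val x = real_of_ereal (extval x)"

text \<open>
  \<open>is_rounding emin emax N R\<close>: the function \<open>R\<close> is rounding to nearest in precision \<open>N\<close>,
  with flush to zero and overflow to infinity. The resolution of ties and the sign of
  a zero result are left open.
\<close>

definition is_rounding :: "int \<Rightarrow> int \<Rightarrow> nat \<Rightarrow> (real \<Rightarrow> fpnum) \<Rightarrow> bool" where
  "is_rounding emin emax N R \<longleftrightarrow> (\<forall>x. R x \<in> fpnums emin emax N \<and>
     (if \<bar>x\<bar> < 2 powi emin then R x \<in> {PosZero, NegZero}
      else if \<bar>x\<bar> > 2 powi emax * (1 - 2 powi (- int N))
        then R x = (if x > 0 then PosInf else NegInf)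
      else is_finite (R x) \<and>
        is_arg_min (\<lambda>y. \<bar>x - y\<bar>) (\<lambda>y. y \<in> unbounded_reals N) (val (R x))))"

definition round_up :: "int \<Rightarrow> int \<Rightarrow> nat \<Rightarrow> ereal \<Rightarrow> fpnum" where
  "round_up emin emax M t = arg_min_on extval {s \<in> fpnums emin emax M. s \<noteq> NaN \<and> t \<le> extval s}"

text \<open>
  An infinite or undefined result has infinite ulp. Hence any overflow in the computation
  of a center makes the radii below infinite, and the disk all of the complex plane.
\<close>

fun ulp :: "int \<Rightarrow> nat \<Rightarrow> fpnum \<Rightarrow> ereal" where
  "ulp emin N PosZero = ereal (2 powi (1 + emin))"
| "ulp emin N NegZero = ereal (2 powi (1 + emin))"
| "ulp emin N (Regular x) = ereal (2 powi (exponent N x - int N))"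
| "ulp emin N PosInf = \<infinity>"
| "ulp emin N NegInf = \<infinity>"
| "ulp emin N NaN = \<infinity>"

text \<open>
  Operations; an operand can be non-finite only after an overflow, in which case
  the value of the result is irrelevant, and \<open>NaN\<close> is used.
\<close>

definition lift_op :: "(real \<Rightarrow> real \<Rightarrow> real) \<Rightarrow> (real \<Rightarrow> fpnum) \<Rightarrow> fpnum \<Rightarrow> fpnum \<Rightarrow> fpnum" where
  "lift_op f R x y = (if is_finite x \<and> is_finite y then R (f (val x) (val y)) else NaN)"

abbreviation fp_add :: "(real \<Rightarrow> fpnum) \<Rightarrow> fpnum \<Rightarrow> fpnum \<Rightarrow> fpnum" where
  "fp_add \<equiv> lift_op (+)"

abbreviation fp_sub :: "(real \<Rightarrow> fpnum) \<Rightarrow> fpnum \<Rightarrow> fpnum \<Rightarrow> fpnum" where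
  "fp_sub \<equiv> lift_op (-)"

abbreviation fp_mult :: "(real \<Rightarrow> fpnum) \<Rightarrow> fpnum \<Rightarrow> fpnum \<Rightarrow> fpnum" where
  "fp_mult \<equiv> lift_op (*)"

type_synonym cfpnum = "fpnum \<times> fpnum"

definition cval :: "cfpnum \<Rightarrow> complex" where
  "cval z = Complex (val (fst z)) (val (snd z))"

fun cfp_add :: "(real \<Rightarrow> fpnum) \<Rightarrow> cfpnum \<Rightarrow> cfpnum \<Rightarrow> cfpnum" where
  "cfp_add R (xa, ya) (xb, yb) = (fp_add R xa xb, fp_add R ya yb)"

fun cfp_scale :: "(real \<Rightarrow> fpnum) \<Rightarrow> fpnum \<Rightarrow> cfpnum \<Rightarrow> cfpnum" where
  "cfp_scale R x (xa, ya) = (fp_mult R x xa, fp_mult R x ya)"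

fun cfp_mult :: "(real \<Rightarrow> fpnum) \<Rightarrow> (real \<Rightarrow> fpnum) \<Rightarrow> cfpnum \<Rightarrow> cfpnum \<Rightarrow> cfpnum" where
  "cfp_mult R R' (xa, ya) (xb, yb) =
     (fp_sub R (fp_mult R' xa xb) (fp_mult R' ya yb),
      fp_add R (fp_mult R' xa yb) (fp_mult R' ya xb))"

definition culp :: "int \<Rightarrow> nat \<Rightarrow> cfpnum \<Rightarrow> ereal" where
  "culp emin N z =
     (if is_finite (fst z) \<and> is_finite (snd z)
      then ereal (sqrt ((real_of_ereal (ulp emin N (fst z)))\<^sup>2 + (real_of_ereal (ulp emin N (snd z)))\<^sup>2))
      else \<infinity>)"

definition is_radius :: "int \<Rightarrow> int \<Rightarrow> nat \<Rightarrow> fpnum \<Rightarrow> bool" where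
  "is_radius emin emax M r \<longleftrightarrow> r \<in> fpnums emin emax M \<and> r \<noteq> NaN \<and> 0 \<le> extval r"

definition disk :: "cfpnum \<Rightarrow> fpnum \<Rightarrow> complex set" where
  "disk z r = {w. ereal (cmod (w - cval z)) < extval r}"

definition interval :: "fpnum \<Rightarrow> fpnum \<Rightarrow> real set" where
  "interval x r = {t. ereal \<bar>t - val x\<bar> < extval r}"

fun center_mult_radius ::
  "int \<Rightarrow> int \<Rightarrow> (nat \<Rightarrow> real \<Rightarrow> fpnum) \<Rightarrow> nat \<Rightarrow> nat \<Rightarrow> nat \<Rightarrow> cfpnum \<Rightarrow> cfpnum \<Rightarrow> fpnum" where
  "center_mult_radius emin emax R N N' M (xa, ya) (xb, yb) =
     round_up emin emax M
       (culp emin N (cfp_mult (R N) (R N') (xa, ya) (xb, yb)) / 2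
        + (\<Sum>u\<leftarrow>[xa, ya]. \<Sum>v\<leftarrow>[xb, yb]. ulp emin N' (fp_mult (R N') u v)) / 2)"

text \<open>Rounding functions exist, and \<open>round_up\<close> is well-defined.\<close>

lemma finite_mantissas: "finite (mantissas N)"
proof -
  let ?f = "\<lambda>m::int. 2 powi (- int N) * real_of_int m"
  have "mantissas N \<subseteq> ?f ` {2^(N-1)..2^N-1} \<union> (\<lambda>m. - ?f m) ` {2^(N-1)..2^N-1}"
    unfolding mantissas_def by auto
  then show ?thesis by (rule finite_subset) auto
qed

lemma finite_fpnums: "finite (fpnums emin emax N)"
  unfolding fpnums_def binade_def by (auto intro: finite_mantissas)

lemma round_up_props:
  shows "round_up emin emax M t \<in> fpnums emin emax M" "round_up emin emax M t \<noteq> NaN"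
    "t \<le> extval (round_up emin emax M t)"
    "\<And>s. \<lbrakk>s \<in> fpnums emin emax M; s \<noteq> NaN; t \<le> extval s\<rbrakk> \<Longrightarrow> extval (round_up emin emax M t) \<le> extval s"
proof -
  let ?S = "{s \<in> fpnums emin emax M. s \<noteq> NaN \<and> t \<le> extval s}"
  have "PosInf \<in> ?S" by (simp add: fpnums_def)
  then have *: "finite ?S" "?S \<noteq> {}" using finite_fpnums by auto
  from arg_min_if_finite[OF this, of extval]
  show "round_up emin emax M t \<in> fpnums emin emax M" "round_up emin emax M t \<noteq> NaN"
    "t \<le> extval (round_up emin emax M t)"
    "\<And>s. \<lbrakk>s \<in> fpnums emin emax M; s \<noteq> NaN; t \<le> extval s\<rbrakk> \<Longrightarrow> extval (round_up emin emax M t) \<le> extval s"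
    unfolding round_up_def by (auto simp: not_less)
qed

lemma mantissas_bounds:
  assumes "z \<in> mantissas N" "N \<ge> 1"
  shows "1/2 \<le> \<bar>z\<bar>" "\<bar>z\<bar> \<le> 1 - 2 powi (- int N)"
proof -
  obtain m :: int where m: "2^(N-1) \<le> m" "m \<le> 2^N - 1" "\<bar>z\<bar> = \<bar>2 powi (- int N) * real_of_int m\<bar>"
    using assms unfolding mantissas_def by auto
  have m0: "m \<ge> 0" using m(1) by (meson order_trans zero_le_numeral zero_le_power)
  have p: "(2::real) powi (- int N) = 1 / 2^N" by (simp add: power_int_minus field_simps)
  have z: "\<bar>z\<bar> = real_of_int m / 2^N" using m(3) m0 by (simp add: p)
  have a: "real_of_int m \<ge> 2^(N-1)" using m(1) by (metis of_int_le_iff of_int_numeral of_int_power)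
  have b: "real_of_int m \<le> 2^N - 1"
  proof -
    have "real_of_int m \<le> real_of_int (2^N - 1)" using m(2) by (simp only: of_int_le_iff)
    then show ?thesis by simp
  qed
  have c: "(2::real)^N = 2 * 2^(N-1)" using assms(2) by (cases N) auto
  show "1/2 \<le> \<bar>z\<bar>" using a unfolding z c by (simp add: field_simps)
  show "\<bar>z\<bar> \<le> 1 - 2 powi (- int N)" using b unfolding z p by (simp add: field_simps)
qed

lemma extreme_mantissas:
  assumes "N \<ge> 1" "s = 1 \<or> s = -1"
  shows "s * (1/2) \<in> mantissas N" "s * (1 - 2 powi (- int N)) \<in> mantissas N"
proof -
  have p: "(2::real) powi (- int N) = 1 / 2^N" by (simp add: power_int_minus field_simps)
  have c: "(2::real)^N = 2 * 2^(N-1)" "(2::int)^N = 2 * 2^(N-1)" using assms(1) by (cases N; simp)+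
  have i: "(1::int) \<le> 2^(N-1)" by simp
  have j: "(2::int)^(N-1) \<le> 2^N - 1" using c(2) i by linarith
  show "s * (1/2) \<in> mantissas N" unfolding mantissas_def
    using assms(2) j by (intro CollectI exI[of _ "2^(N-1)"]) (auto simp: p c(1))
  show "s * (1 - 2 powi (- int N)) \<in> mantissas N" unfolding mantissas_def
    using assms(2) j by (intro CollectI exI[of _ "2^N-1"]) (auto simp: p field_simps)
qed

lemma ex_rounding:
  assumes "N \<ge> 1" "emin < 0" "emax > 0"
  shows "\<exists>R. is_rounding emin emax N R"
proof -
  define F where "F = (\<Union>e\<in>{emin..emax}. binade N e)"
  define top where "top = 2 powi emax * (1 - 2 powi (- int N) :: real)"
  define low where "low = (2 powi emin * (1/2) :: real)"
  have F: "finite F" unfolding F_def binade_def by (auto intro: finite_mantissas)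
  have lowF: "s * low \<in> F" and topF: "s * top \<in> F" if "s = 1 \<or> s = -1" for s
  proof -
    have "s * low \<in> binade N emin" unfolding binade_def low_def
      using extreme_mantissas(1)[OF assms(1) that] by (auto intro!: image_eqI[of _ _ "s * (1/2)"])
    then show "s * low \<in> F" using assms unfolding F_def by force
    have "s * top \<in> binade N emax" unfolding binade_def top_def
      using extreme_mantissas(2)[OF assms(1) that]
      by (auto intro!: image_eqI[of _ _ "s * (1 - 2 powi (- int N))"] simp: algebra_simps)
    then show "s * top \<in> F" using assms unfolding F_def by force
  qed
  have nearest: "\<exists>y\<in>F. is_arg_min (\<lambda>y. \<bar>x - y\<bar>) (\<lambda>y. y \<in> unbounded_reals N) y"
    if x: "2 powi emin \<le> \<bar>x\<bar>" "\<bar>x\<bar> \<le> top" for x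
  proof -
    obtain y where y: "y \<in> F" "\<And>w. w \<in> F \<Longrightarrow> \<bar>x - y\<bar> \<le> \<bar>x - w\<bar>"
      using ex_is_arg_min_if_finite[OF F, of "\<lambda>y. \<bar>x - y\<bar>"] lowF[of 1]
      by (auto simp: is_arg_min_linorder)
    have FU: "F \<subseteq> unbounded_reals N" unfolding F_def unbounded_reals_def by auto
    have low0: "0 < low" "low < 2 powi emin" unfolding low_def by auto
    have x0: "x \<noteq> 0" using x(1) low0 by auto
    then have sgn: "sgn x = 1 \<or> sgn x = -1" by (auto simp: sgn_if)
    have l: "\<bar>x - y\<bar> \<le> \<bar>x\<bar> - low" using y(2)[OF lowF[OF sgn]] x low0 x0 by (auto simp: sgn_if split: if_splits)
    have t: "\<bar>x - y\<bar> \<le> top - \<bar>x\<bar>" using y(2)[OF topF[OF sgn]] x low0 x0 by (auto simp: sgn_if split: if_splits)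
    have "\<bar>x - y\<bar> \<le> \<bar>x - w\<bar>" if w: "w \<in> unbounded_reals N" for w
    proof (cases "w = 0 \<or> w \<in> F")
      case True then show ?thesis using y(2) l low0 by auto
    next
      case False
      then obtain e z where e: "w = 2 powi e * z" "z \<in> mantissas N" "e < emin \<or> e > emax"
        using w unfolding unbounded_reals_def F_def binade_def by fastforce
      note z = mantissas_bounds[OF e(2) assms(1)]
      have aw: "\<bar>w\<bar> = 2 powi e * \<bar>z\<bar>" using e(1) by (simp add: abs_mult)
      from e(3) show ?thesis
      proof
        assume "e < emin"
        then have "(2::real) powi e \<le> 2 powi (emin - 1)" by (intro power_int_increasing) auto
        also have "\<dots> = low" unfolding low_def by (simp add: power_int_diff)
        finally have "(2::real) powi e \<le> low" .
        moreover have "\<bar>w\<bar> \<le> 2 powi e" unfolding aw using z(2)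
          by (intro mult_left_le) (auto intro: order_trans[OF z(2)])
        ultimately show ?thesis using l by linarith
      next
        assume "e > emax"
        then have "(2::real) powi (emax + 1) \<le> 2 powi e" by (intro power_int_increasing) auto
        then have "(2::real) powi emax \<le> 2 powi e * (1/2)" by (simp add: power_int_add)
        also have "\<dots> \<le> \<bar>w\<bar>" unfolding aw using z(1) by (intro mult_left_mono) auto
        finally have "2 powi emax \<le> \<bar>w\<bar>" .
        moreover have "top \<le> 2 powi emax" unfolding top_def by (intro mult_left_le) auto
        ultimately show ?thesis using t by linarith
      qed
    qed
    then have "is_arg_min (\<lambda>y. \<bar>x - y\<bar>) (\<lambda>y. y \<in> unbounded_reals N) y"
      using y(1) FU by (auto simp: is_arg_min_linorder)
    then show ?thesis using y(1) by blast
  qed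
  have "\<exists>v. v \<in> fpnums emin emax N \<and>
     (if \<bar>x\<bar> < 2 powi emin then v \<in> {PosZero, NegZero}
      else if \<bar>x\<bar> > top then v = (if x > 0 then PosInf else NegInf)
      else is_finite v \<and> is_arg_min (\<lambda>y. \<bar>x - y\<bar>) (\<lambda>y. y \<in> unbounded_reals N) (val v))" for x
  proof -
    consider "\<bar>x\<bar> < 2 powi emin" | "\<not> \<bar>x\<bar> < 2 powi emin" "\<bar>x\<bar> > top"
      | "2 powi emin \<le> \<bar>x\<bar>" "\<bar>x\<bar> \<le> top" by linarith
    then show ?thesis
    proof cases
      case 1 then show ?thesis by (intro exI[of _ PosZero]) (simp add: fpnums_def)
    next
      case 2 then show ?thesis
        by (intro exI[of _ "if x > 0 then PosInf else NegInf"]) (simp add: fpnums_def)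
    next
      case 3
      from nearest[OF this] obtain y where
        "y \<in> F" "is_arg_min (\<lambda>y. \<bar>x - y\<bar>) (\<lambda>y. y \<in> unbounded_reals N) y" by blast
      with 3 show ?thesis
        by (intro exI[of _ "Regular y"]) (auto simp: fpnums_def F_def is_finite_def val_def)
    qed
  qed
  then show ?thesis unfolding is_rounding_def top_def by metis
qed

end

theory Submission
  imports Defs
begin

text \<open>
  Rounding to nearest is off by at most half an ulp of the result, and a result flushed to zero
  by less than \<open>2 powi emin\<close>, which is half the ulp of a zero. Infinite ulps make
  these bounds hold after an overflow as well, so all error estimates can be stated
  unconditionally in the extended reals. In part (2) all bounds for the single errors may be
  attained, but the errors of the four products are added up in the 1-norm of the plane, and both
  coordinates of the resulting bound are positive; hence the Euclidean norm is strictly smaller.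
\<close>

section \<open>Rounding error of a single real operation\<close>

text \<open>Supplies the grid points that compete with a rounded value, among them those across a
  binade boundary. Changing the exponent by one while halving or doubling \<open>m\<close>
  normalizes the mantissa.\<close>

lemma scaled_int_in_unbounded_reals:
  assumes "N \<ge> 1" "\<bar>m\<bar> \<le> 2 ^ N"
  shows "2 powi k * real_of_int m \<in> unbounded_reals N"
  using assms(2)
\<comment> \<open>A nonzero \<open>m\<close> that is too small gets doubled, which shrinks its
  distance to \<open>2 ^ N\<close>.\<close>
proof (induction "nat (2 ^ N - \<bar>m\<bar>)" arbitrary: m k rule: less_induct)
  case less
  have pow: "(2::int) ^ N = 2 * 2 ^ (N - 1)" using assms(1) by (cases N) auto
  have binadeI: "2 powi j * real_of_int n \<in> unbounded_reals N"
    if n: "2 ^ (N - 1) \<le> \<bar>n\<bar>" "\<bar>n\<bar> \<le> 2 ^ N - 1" for n j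
  proof -
    have "2 powi (- int N) * real_of_int n \<in> mantissas N"
      unfolding mantissas_def using n by (intro CollectI exI[of _ "\<bar>n\<bar>"]) (auto simp: abs_if)
    moreover have "2 powi j * real_of_int n = 2 powi (j + int N) * (2 powi (- int N) * real_of_int n)"
      by (simp add: power_int_add power_int_minus)
    ultimately show ?thesis unfolding unbounded_reals_def binade_def by blast
  qed
  consider "m = 0" | "2 ^ (N - 1) \<le> \<bar>m\<bar>" "\<bar>m\<bar> \<le> 2 ^ N - 1" | "\<bar>m\<bar> = 2 ^ N"
    | "m \<noteq> 0" "\<bar>m\<bar> < 2 ^ (N - 1)"
    using less.prems by linarith
  then show ?case
  proof cases
    case 1
    then show ?thesis by (simp add: unbounded_reals_def)
  next
    case 2
    then show ?thesis by (rule binadeI)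
  next
    case 3
    \<comment> \<open>Mantissas stop at \<open>2 ^ N - 1\<close>; the value with
      \<open>2 ^ N\<close> is the least one of the next binade.\<close>
    then obtain n where n: "m = 2 * n" "\<bar>n\<bar> = 2 ^ (N - 1)"
      using pow by (cases "m \<ge> 0") (auto intro: that[of "2 ^ (N - 1)"] that[of "- (2 ^ (N - 1))"])
    have "(1::int) \<le> 2 ^ (N - 1)" by simp
    then have "2 powi (k + 1) * real_of_int n \<in> unbounded_reals N"
      by (intro binadeI) (use n pow in linarith)+
    then show ?thesis by (simp add: n power_int_add mult.assoc)
  next
    case 4
    then have "2 powi (k - 1) * real_of_int (2 * m) \<in> unbounded_reals N"
      by (intro less.hyps) (use pow in auto)
    then show ?thesis by (simp add: power_int_diff)
  qed
qed

lemma binade_bounds: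
  assumes "N \<ge> 1" "x \<in> binade N e"
  shows "2 powi (e - 1) \<le> \<bar>x\<bar>" "\<bar>x\<bar> < 2 powi e"
proof -
  obtain z where z: "x = 2 powi e * z" "z \<in> mantissas N" using assms(2) unfolding binade_def by blast
  note b = mantissas_bounds[OF z(2) assms(1)]
  have "(0::real) < 2 powi (- int N)" by simp
  then have "\<bar>z\<bar> < 1" using b(2) by linarith
  then show "\<bar>x\<bar> < 2 powi e" by (simp add: z abs_mult)
  show "2 powi (e - 1) \<le> \<bar>x\<bar>" using b(1) by (simp add: z abs_mult power_int_diff)
qed

text \<open>Distinct binades occupy disjoint ranges of absolute values, so the description in
  \<open>exponent\<close> has a unique solution.\<close>

lemma exponent_eq:
  assumes "N \<ge> 1" "x \<in> binade N e"
  shows "exponent N x = e"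
  unfolding exponent_def
proof (rule the_equality)
  have le: "i \<le> j" if "x \<in> binade N i" "x \<in> binade N j" for i j
  proof (rule ccontr)
    assume "\<not> i \<le> j"
    then have "(2::real) powi j \<le> 2 powi (i - 1)" by (intro power_int_increasing) auto
    then show False using binade_bounds[OF assms(1)] that by fastforce
  qed
  show "e' = e" if "x \<in> binade N e'" for e'
    using le[OF that assms(2)] le[OF assms(2) that] by simp
qed (fact assms(2))

text \<open>Both \<open>y + u\<close> and \<open>y - u\<close>, with \<open>u\<close> the ulp of
  \<open>y\<close>, are on the unbounded grid, and \<open>y\<close> is at least as close to
  \<open>x\<close> as either of them. At the lower end of a binade the grid is finer towards zero,
  which does no harm.\<close>

lemma nearest_error:
  assumes "N \<ge> 1" "y \<in> binade N e"
    and min: "is_arg_min (\<lambda>y. \<bar>x - y\<bar>) (\<lambda>y. y \<in> unbounded_reals N) y"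
  shows "\<bar>x - y\<bar> \<le> 2 powi (e - int N) / 2"
proof -
  define u :: real where "u = 2 powi (e - int N)"
  have "u > 0" by (simp add: u_def)
  obtain m :: int where m: "y = u * real_of_int m" "\<bar>m\<bar> \<le> 2 ^ N - 1"
  proof -
    obtain n :: int where n: "2 ^ (N - 1) \<le> n" "n \<le> 2 ^ N - 1"
      "y = 2 powi e * (2 powi (- int N) * real_of_int n) \<or>
       y = 2 powi e * - (2 powi (- int N) * real_of_int n)"
      using assms(2) unfolding binade_def mantissas_def by blast
    have "n \<ge> 0" using n(1) by (meson order_trans zero_le_numeral zero_le_power)
    moreover have "2 powi e * 2 powi (- int N) = u"
      unfolding u_def by (simp flip: power_int_add)
    ultimately show thesis using n
      by (intro that[of "if y = u * real_of_int n then n else - n"])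
        (auto simp: mult.assoc[symmetric])
  qed
  \<comment> \<open>The bound \<open>2 ^ N - 1\<close> on \<open>m\<close> leaves room for one step
    in either direction.\<close>
  have "u * real_of_int (m + i) \<in> unbounded_reals N" if "\<bar>i\<bar> \<le> 1" for i
    unfolding u_def using m(2) that by (intro scaled_int_in_unbounded_reals assms(1)) linarith
  from this[of 1] this[of "-1"] have "y + u \<in> unbounded_reals N" "y - u \<in> unbounded_reals N"
    by (simp_all add: m algebra_simps)
  then have "\<bar>x - y\<bar> \<le> \<bar>x - (y + u)\<bar>" "\<bar>x - y\<bar> \<le> \<bar>x - (y - u)\<bar>"
    using min by (auto simp: is_arg_min_linorder)
  then show ?thesis using \<open>u > 0\<close> unfolding u_def[symmetric] by linarith
qed

lemma rounding_error:
  assumes "N \<ge> 1" and R: "is_rounding emin emax N R"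
  shows "ereal \<bar>val (R x) - x\<bar> \<le> ulp emin N (R x) / 2"
proof -
  have min: "is_arg_min (\<lambda>y. \<bar>x - y\<bar>) (\<lambda>y. y \<in> unbounded_reals N) (val (R x))"
    if "is_finite (R x)" "\<not> \<bar>x\<bar> < 2 powi emin"
    using R that unfolding is_rounding_def by (metis is_finite_def insertCI)
  have flush: "\<bar>x\<bar> < 2 powi emin" if zero: "R x = PosZero \<or> R x = NegZero"
  proof (rule ccontr)
    assume large: "\<not> \<bar>x\<bar> < 2 powi emin"
    \<comment> \<open>The points \<open>2 powi emin\<close> and its negative are on the grid; the
      one with the sign of \<open>x\<close> is strictly nearer to \<open>x\<close> than zero, so
      zero can only come from flushing.\<close>
    have "2 powi emin * real_of_int s \<in> unbounded_reals N" if "\<bar>s\<bar> = 1" for s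
      by (rule scaled_int_in_unbounded_reals) (use assms(1) that in auto)
    from this[of 1] this[of "-1"]
    have "\<bar>x\<bar> \<le> \<bar>x - 2 powi emin\<bar>" "\<bar>x\<bar> \<le> \<bar>x - - (2 powi emin)\<bar>"
      using min[OF _ large] zero
      by (auto simp: is_finite_def is_arg_min_linorder val_def simp del: diff_minus_eq_add)
    then show False using large zero_less_power_int[of "2::real" emin] by linarith
  qed
  have "R x \<in> fpnums emin emax N" using R unfolding is_rounding_def by blast
  then consider "R x = PosZero \<or> R x = NegZero" | "R x = PosInf \<or> R x = NegInf \<or> R x = NaN"
    | y e where "R x = Regular y" "y \<in> binade N e"
    unfolding fpnums_def by blast
  then show ?thesis
  proof cases
    case 1
    then show ?thesis using flush by (auto simp: val_def power_int_add)
  next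
    case 2
    then show ?thesis by auto
  next
    case 3
    have "\<not> \<bar>x\<bar> < 2 powi emin" using R 3(1) unfolding is_rounding_def
      by (metis fpnum.distinct insertE singletonD)
    then have "\<bar>x - y\<bar> \<le> 2 powi (e - int N) / 2"
      using min 3 by (intro nearest_error[OF assms(1) 3(2)]) (auto simp: is_finite_def val_def)
    then show ?thesis using exponent_eq[OF assms(1) 3(2)] 3(1) by (simp add: val_def abs_minus_commute)
  qed
qed

text \<open>A non-finite operand produces \<open>NaN\<close>, whose ulp is infinite; the bound
  therefore also covers chained operations after an overflow.\<close>

lemma lift_op_error:
  assumes "N \<ge> 1" "is_rounding emin emax N R"
  shows "ereal \<bar>val (lift_op f R x y) - f (val x) (val y)\<bar> \<le> ulp emin N (lift_op f R x y) / 2"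
  using rounding_error[OF assms] by (simp add: lift_op_def)

section \<open>Rounding errors of complex operations\<close>

lemma ulp_pos: "0 < ulp emin N x"
  by (cases x) auto

lemma ulp_finite:
  assumes "is_finite x"
  obtains u where "ulp emin N x = ereal u" "u > 0"
  using assms by (cases x) (auto simp: is_finite_def)

text \<open>Half of the complex ulp is the Euclidean norm of the two half ulps, and this norm is
  monotone in the absolute values of the coordinates.\<close>

lemma culp_error:
  assumes "ereal \<bar>val (fst z) - s\<bar> \<le> ulp emin N (fst z) / 2"
    and "ereal \<bar>val (snd z) - t\<bar> \<le> ulp emin N (snd z) / 2"
  shows "ereal (cmod (cval z - Complex s t)) \<le> culp emin N z / 2"
proof (cases "is_finite (fst z) \<and> is_finite (snd z)")
  case True
  then obtain u v where u: "ulp emin N (fst z) = ereal u" "u > 0"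
    and v: "ulp emin N (snd z) = ereal v" "v > 0"
    by (metis ulp_finite)
  have "\<bar>val (fst z) - s\<bar> \<le> \<bar>u / 2\<bar>" "\<bar>val (snd z) - t\<bar> \<le> \<bar>v / 2\<bar>"
    using assms u v by auto
  then have "(val (fst z) - s)\<^sup>2 + (val (snd z) - t)\<^sup>2 \<le> (u / 2)\<^sup>2 + (v / 2)\<^sup>2"
    unfolding abs_le_square_iff by (rule add_mono)
  also have "\<dots> = (u\<^sup>2 + v\<^sup>2) / 2\<^sup>2" by (simp add: power_divide add_divide_distrib)
  finally have "cmod (cval z - Complex s t) \<le> sqrt ((u\<^sup>2 + v\<^sup>2) / 2\<^sup>2)"
    by (simp add: cval_def cmod_def)
  then show ?thesis using True by (simp add: culp_def u v real_sqrt_divide)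
qed (auto simp: culp_def)

lemma cfp_add_error:
  assumes "N \<ge> 1" "is_rounding emin emax N R"
  shows "ereal (cmod (cval (cfp_add R z w) - (cval z + cval w))) \<le> culp emin N (cfp_add R z w) / 2"
proof -
  have eq: "cval z + cval w = Complex (val (fst z) + val (fst w)) (val (snd z) + val (snd w))"
    by (simp add: cval_def complex_eq_iff)
  show ?thesis unfolding eq
    by (rule culp_error; cases z; cases w; simp only: fst_conv snd_conv cfp_add.simps lift_op_error[OF assms])
qed

lemma cfp_scale_error:
  assumes "N \<ge> 1" "is_rounding emin emax N R"
  shows "ereal (cmod (cval (cfp_scale R x z) - of_real (val x) * cval z))
    \<le> culp emin N (cfp_scale R x z) / 2"
proof -
  have eq: "of_real (val x) * cval z = Complex (val x * val (fst z)) (val x * val (snd z))"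
    by (simp add: cval_def complex_eq_iff)
  show ?thesis unfolding eq
    by (rule culp_error; cases z; simp only: fst_conv snd_conv cfp_scale.simps lift_op_error[OF assms])
qed

text \<open>The cross term \<open>2 * A * B\<close> makes the inequality strict, as membership in an
  open disk requires.\<close>

lemma cmod_Complex_less:
  assumes "\<bar>a\<bar> \<le> A" "\<bar>b\<bar> \<le> B" "A > 0" "B > 0"
  shows "cmod (Complex a b) < A + B"
proof -
  have "a\<^sup>2 + b\<^sup>2 \<le> A\<^sup>2 + B\<^sup>2"
    using assms by (intro add_mono) (auto simp flip: abs_le_square_iff)
  also have "\<dots> < (A + B)\<^sup>2" using assms by (simp add: power2_sum)
  finally show ?thesis
    using assms by (simp add: cmod_def real_less_lsqrt)
qed

text \<open>Combines a weak bound on one error with a strict bound on another; \<open>z\<close> is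
  the total error from a triangle inequality. Infinite bounds are harmless because the errors are
  real.\<close>

lemma ereal_less_add:
  assumes "ereal x \<le> a" "ereal y < b" "z \<le> x + y"
  shows "ereal z < a + b"
  using assms by (cases a; cases b) auto

lemma cfp_mult_error:
  assumes "N \<ge> 1" "is_rounding emin emax N R" "N' \<ge> 1" "is_rounding emin emax N' R'"
  shows "ereal (cmod (cval (xa, ya) * cval (xb, yb) - cval (cfp_mult R R' (xa, ya) (xb, yb)))) <
    culp emin N (cfp_mult R R' (xa, ya) (xb, yb)) / 2
      + (\<Sum>u\<leftarrow>[xa, ya]. \<Sum>v\<leftarrow>[xb, yb]. ulp emin N' (fp_mult R' u v)) / 2"
proof -
  define p where "p u v = val (fp_mult R' u v)" for u v
  define U where "U u v = ulp emin N' (fp_mult R' u v)" for u v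
  let ?c = "cfp_mult R R' (xa, ya) (xb, yb)"
  \<comment> \<open>The intermediate point \<open>?d\<close> combines the rounded products exactly:
    its distance to \<open>?c\<close> is due to the last rounding, its distance to the true product
    to the four multiplications.\<close>
  let ?d = "Complex (p xa xb - p ya yb) (p xa yb + p ya xb)"
  have U_pos: "U u v > 0" for u v by (simp add: U_def ulp_pos)
  have p_error: "ereal \<bar>p u v - val u * val v\<bar> \<le> U u v / 2" for u v
    unfolding p_def U_def by (rule lift_op_error[OF assms(3,4)])
  have "ereal (cmod (cval ?c - ?d)) \<le> culp emin N ?c / 2"
    unfolding p_def by (rule culp_error; simp only: fst_conv snd_conv cfp_mult.simps lift_op_error[OF assms(1,2)])
  moreover have "ereal (cmod (?d - cval (xa, ya) * cval (xb, yb)))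
    < (U xa xb + U xa yb + (U ya xb + U ya yb)) / 2"
  proof (cases "\<forall>u \<in> {xa, ya}. \<forall>v \<in> {xb, yb}. U u v \<noteq> \<infinity>")
    case True
    have "U u v = ereal (real_of_ereal (U u v))" if "u \<in> {xa, ya}" "v \<in> {xb, yb}" for u v
      using True that U_pos[of u v] by (cases "U u v") auto
    then obtain r where r: "\<And>u v. u \<in> {xa, ya} \<Longrightarrow> v \<in> {xb, yb} \<Longrightarrow> U u v = ereal (r u v)"
      by meson
    have e: "\<bar>p u v - val u * val v\<bar> \<le> r u v / 2" "r u v > 0" if "u \<in> {xa, ya}" "v \<in> {xb, yb}" for u v
      using p_error[of u v] U_pos[of u v] by (auto simp: r[OF that])
    \<comment> \<open>Each coordinate collects the errors of two of the four products, so adding the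
      coordinate bounds uses every half ulp once.\<close>
    have "?d - cval (xa, ya) * cval (xb, yb) =
      Complex ((p xa xb - val xa * val xb) - (p ya yb - val ya * val yb))
        ((p xa yb - val xa * val yb) + (p ya xb - val ya * val xb))"
      by (simp add: cval_def complex_eq_iff)
    moreover have "cmod \<dots> < (r xa xb / 2 + r ya yb / 2) + (r xa yb / 2 + r ya xb / 2)"
      by (intro cmod_Complex_less order_trans[OF abs_triangle_ineq4] order_trans[OF abs_triangle_ineq]
          add_mono add_pos_pos half_gt_zero e) auto
    ultimately show ?thesis by (simp add: r field_simps)
  next
    case False
    \<comment> \<open>One product has overflowed; as all ulps are positive, its infinite ulp cannot
      cancel.\<close>
    then have "U xa xb + U xa yb + (U ya xb + U ya yb) = \<infinity>"
      using U_pos by fastforce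
    then show ?thesis by (simp only:) simp
  qed
  moreover have "cmod (cval (xa, ya) * cval (xb, yb) - cval ?c)
    \<le> cmod (cval ?c - ?d) + cmod (?d - cval (xa, ya) * cval (xb, yb))"
    by (subst norm_minus_commute) (simp only: dist_norm[symmetric] dist_triangle)
  ultimately have "ereal (cmod (cval (xa, ya) * cval (xb, yb) - cval ?c))
    < culp emin N ?c / 2 + (U xa xb + U xa yb + (U ya xb + U ya yb)) / 2"
    by (rule ereal_less_add)
  then show ?thesis by (simp only: U_def list.map sum_list.Cons sum_list.Nil add_0_right)
qed

section \<open>Inclusions of disks\<close>

lemma disk_round_upI:
  assumes "ereal (cmod (w - cval z)) < t"
  shows "w \<in> disk z (round_up emin emax M t)"
  using order_less_le_trans[OF assms round_up_props(3)] by (simp add: disk_def)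

text \<open>The input disks being open gives the strict inequality; the rounding error of the center
  is bounded only weakly.\<close>

lemma disk_add_subset:
  assumes "N \<ge> 1" "is_rounding emin emax N R"
  shows "disk za ra + disk zb rb \<subseteq> disk (cfp_add R za zb)
    (round_up emin emax M (extval ra + extval rb + culp emin N (cfp_add R za zb) / 2))"
proof
  fix w assume "w \<in> disk za ra + disk zb rb"
  then obtain a b where w: "w = a + b" and a: "a \<in> disk za ra" and b: "b \<in> disk zb rb"
    by (auto elim: set_plus_elim)
  let ?c = "cfp_add R za zb"
  have "ereal (cmod (a - cval za) + cmod (b - cval zb)) < extval ra + extval rb"
    using a b by (intro ereal_less_add[OF _ _ order_refl]) (auto simp: disk_def)
  moreover have "cmod (w - cval ?c)
    \<le> cmod (cval ?c - (cval za + cval zb)) + (cmod (a - cval za) + cmod (b - cval zb))"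
  proof -
    have "w - cval ?c = - (cval ?c - (cval za + cval zb)) + ((a - cval za) + (b - cval zb))"
      by (simp add: w)
    then show ?thesis by (metis norm_minus_cancel norm_triangle_le norm_triangle_mono order_refl)
  qed
  ultimately have "ereal (cmod (w - cval ?c)) < culp emin N ?c / 2 + (extval ra + extval rb)"
    by (rule ereal_less_add[OF cfp_add_error[OF assms]])
  then show "w \<in> disk ?c (round_up emin emax M (extval ra + extval rb + culp emin N ?c / 2))"
    by (intro disk_round_upI) (simp only: add.commute)
qed

lemma center_mult_in_disk:
  assumes "N \<ge> 1" "is_rounding emin emax N (R N)" "N' \<ge> 1" "is_rounding emin emax N' (R N')"
  shows "cval za * cval zb \<in>
    disk (cfp_mult (R N) (R N') za zb) (center_mult_radius emin emax R N N' M za zb)"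
  by (cases za; cases zb; simp only: center_mult_radius.simps)
    (intro disk_round_upI cfp_mult_error[OF assms])

text \<open>Rounding enters only through the assumption on the product of the centers, whose
  strictness carries over to the whole estimate.\<close>

lemma disk_mult_subset:
  assumes center: "cval za * cval zb \<in> disk c s"
  shows "disk za ra * disk zb rb \<subseteq> disk c (round_up emin emax M
    (extval ra * extval rb + extval ra * ereal (cmod (cval zb)) + extval rb * ereal (cmod (cval za))
      + extval s))"
proof
  fix w assume "w \<in> disk za ra * disk zb rb"
  then obtain a b where w: "w = a * b" and a: "a \<in> disk za ra" and b: "b \<in> disk zb rb"
    by (auto elim: set_times_elim)
  let ?da = "cmod (a - cval za)" and ?db = "cmod (b - cval zb)"
  \<comment> \<open>Weak bounds are kept here, since a term such as
    \<open>?da * cmod (cval zb)\<close> gives no strict inequality for a center at zero.\<close>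
  have le: "ereal ?da \<le> extval ra" "ereal ?db \<le> extval rb"
    using a b by (auto simp: disk_def)
  have "ereal ?da * ereal ?db + ereal ?da * ereal (cmod (cval zb)) + ereal ?db * ereal (cmod (cval za))
    \<le> extval ra * extval rb + extval ra * ereal (cmod (cval zb)) + extval rb * ereal (cmod (cval za))"
    \<comment> \<open>The radii are nonnegative because they bound the distances of actual points of
      the disks.\<close>
    using le order_trans[OF _ le(1), of 0] order_trans[OF _ le(2), of 0] by (intro add_mono ereal_mult_mono) auto
  then have "ereal (?da * ?db + ?da * cmod (cval zb) + ?db * cmod (cval za))
    \<le> extval ra * extval rb + extval ra * ereal (cmod (cval zb)) + extval rb * ereal (cmod (cval za))"
    by simp
  moreover have "ereal (cmod (cval za * cval zb - cval c)) < extval s"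
    using center by (simp add: disk_def)
  moreover have "cmod (w - cval c) \<le>
    ?da * ?db + ?da * cmod (cval zb) + ?db * cmod (cval za) + cmod (cval za * cval zb - cval c)"
  proof -
    have "w - cval c = (a - cval za) * (b - cval zb) + (a - cval za) * cval zb
      + (b - cval zb) * cval za + (cval za * cval zb - cval c)"
      by (simp add: w algebra_simps)
    then show ?thesis by (simp only: norm_mult[symmetric]) (intro norm_triangle_mono order_refl)
  qed
  ultimately show "w \<in> disk c (round_up emin emax M
    (extval ra * extval rb + extval ra * ereal (cmod (cval zb)) + extval rb * ereal (cmod (cval za))
      + extval s))"
    by (intro disk_round_upI) (rule ereal_less_add)
qed

text \<open>Splitting \<open>t * a - x * z\<close> asymmetrically as
  \<open>(t - x) * z + t * (a - z)\<close> yields the two radius terms, with \<open>t\<close>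
  bounded by the absolute value of \<open>x\<close> plus \<open>r\<close>.\<close>

lemma interval_mult_disk_subset:
  assumes "N \<ge> 1" "is_rounding emin emax N R"
  shows "complex_of_real ` interval x r * disk z s \<subseteq> disk (cfp_scale R x z)
    (round_up emin emax M ((ereal \<bar>val x\<bar> + extval r) * extval s + extval r * ereal (cmod (cval z))
      + culp emin N (cfp_scale R x z) / 2))"
proof
  fix w assume "w \<in> complex_of_real ` interval x r * disk z s"
  then obtain t a where w: "w = of_real t * a" and t: "t \<in> interval x r" and a: "a \<in> disk z s"
    by (auto elim!: set_times_elim)
  let ?c = "cfp_scale R x z"
  have t': "ereal \<bar>t - val x\<bar> < extval r" and a': "ereal (cmod (a - cval z)) < extval s"
    using t a by (auto simp: interval_def disk_def)
  have "ereal (\<bar>t - val x\<bar> * cmod (cval z)) \<le> extval r * ereal (cmod (cval z))"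
    using ereal_mult_right_mono[OF less_imp_le[OF t'], of "ereal (cmod (cval z))"] by simp
  moreover have "ereal (\<bar>t\<bar> * cmod (a - cval z)) < (ereal \<bar>val x\<bar> + extval r) * extval s"
  proof -
    have "ereal \<bar>t\<bar> < ereal \<bar>val x\<bar> + extval r"
      by (rule ereal_less_add[OF order_refl t']) simp
    \<comment> \<open>Both factors on the right are strictly larger than nonnegative numbers, hence
      positive: their product is strictly larger too, and infinite as soon as one of them
      is.\<close>
    then show ?thesis using a'
      by (cases "ereal \<bar>val x\<bar> + extval r"; cases "extval s")
        (auto intro: mult_strict_mono' order_le_less_trans[OF norm_ge_zero] order_le_less_trans[OF abs_ge_zero])
  qed
  ultimately have "ereal (\<bar>t - val x\<bar> * cmod (cval z) + \<bar>t\<bar> * cmod (a - cval z))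
    < extval r * ereal (cmod (cval z)) + (ereal \<bar>val x\<bar> + extval r) * extval s"
    by (rule ereal_less_add) simp
  moreover have "cmod (w - cval ?c) \<le> cmod (cval ?c - of_real (val x) * cval z)
    + (\<bar>t - val x\<bar> * cmod (cval z) + \<bar>t\<bar> * cmod (a - cval z))"
  proof -
    have "w - cval ?c = (of_real (val x) * cval z - cval ?c)
      + (of_real (t - val x) * cval z + of_real t * (a - cval z))"
      by (simp add: w algebra_simps)
    then show ?thesis
      by (metis norm_minus_commute norm_mult norm_of_real norm_triangle_mono order_refl)
  qed
  ultimately have "ereal (cmod (w - cval ?c)) < culp emin N ?c / 2 +
    (extval r * ereal (cmod (cval z)) + (ereal \<bar>val x\<bar> + extval r) * extval s)"
    by (rule ereal_less_add[OF cfp_scale_error[OF assms]])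
  then show "w \<in> disk ?c (round_up emin emax M
    ((ereal \<bar>val x\<bar> + extval r) * extval s + extval r * ereal (cmod (cval z)) + culp emin N ?c / 2))"
    by (intro disk_round_upI) (simp only: add.commute)
qed

theorem theorem8:
  fixes N M N' :: nat and emin emax :: int
    and R :: "nat \<Rightarrow> real \<Rightarrow> fpnum"
    and xa ya xb yb ra rb :: fpnum and za zb :: cfpnum
  assumes "emin < 0" "emax > 0"
    and "\<And>K. K \<ge> 1 \<Longrightarrow> is_rounding emin emax K (R K)"
    and "N \<ge> 1" "M \<ge> 1" "N' \<ge> 1" "N' \<ge> N"
    and "xa \<in> fpnums emin emax N" "ya \<in> fpnums emin emax N"
      "xb \<in> fpnums emin emax N" "yb \<in> fpnums emin emax N"
    and "is_finite xa" "is_finite ya" "is_finite xb" "is_finite yb"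
    and "za = (xa, ya)" and "zb = (xb, yb)"
    and "is_radius emin emax M ra" "is_radius emin emax M rb"
  shows "disk za ra + disk zb rb \<subseteq>
      disk (cfp_add (R N) za zb)
        (round_up emin emax M (extval ra + extval rb + culp emin N (cfp_add (R N) za zb) / 2))
    \<and> cval za * cval zb \<in>
      disk (cfp_mult (R N) (R N') za zb) (center_mult_radius emin emax R N N' M za zb)
    \<and> disk za ra * disk zb rb \<subseteq>
      disk (cfp_mult (R N) (R N') za zb)
        (round_up emin emax M
          (extval ra * extval rb + extval ra * ereal (cmod (cval zb)) + extval rb * ereal (cmod (cval za))
           + extval (center_mult_radius emin emax R N N' M za zb)))
    \<and> (\<forall>x r. x \<in> fpnums emin emax N \<and> is_finite x \<and> is_radius emin emax M r \<longrightarrow>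
      complex_of_real ` interval x r * disk za ra \<subseteq>
      disk (cfp_scale (R N) x za)
        (round_up emin emax M
          ((ereal \<bar>val x\<bar> + extval r) * extval ra + extval r * ereal (cmod (cval za))
           + culp emin N (cfp_scale (R N) x za) / 2)))"
  using assms(3,4,6)
  by (intro conjI allI impI disk_add_subset disk_mult_subset center_mult_in_disk
      interval_mult_disk_subset) auto

end
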